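(* For any $n,a,b\in\mathbb{N}$ satisfying $a\geq b$, we have that \begin{equation} i(P(n,a,b))=U_{n+2}(a,-b), \end{equation} and that \begin{equation} i(C(n,a,b))=V_n(a,-b). \end{equation}
   Context: For a graph $G$, a set $S$ of vertices is an independent set if no two vertices of $S$ are adjacent; $i(G)$ denotes the total number of independent sets of $G$ (including the empty set). For $n,a,b\in\mathbb{N}$ with $a\geq b$, the chainsaw graph $C(n,a,b)$ is built as follows: create an $n$-vertex cycle with vertex set $\mathbb{Z}_n$ (the $1$-vertex cycle being a vertex with a loop, the $2$-vertex cycle a single edge); for each vertex of the cycle, create an $a$-vertex complete graph sharing with the cycle only this vertex; then, for each $v\in\mathbb{Z}_n$, make vertex $v$ adjacent to $a-b$ additional vertices of the complete graph containing vertex $v+1 \pmod n$. The $n$ cycle vertices are called chain vertices and the rest blade vertices. The broken chainsaw $P(n,a,b)$ is obtained from $C(n+1,a,b)$ by removing one chain vertex (e.g. vertex $0$) and all edges adjacent to it. The Lucas sequences are $U_0(a,b)=0$, $U_1(a,b)=1$, $U_n(a,b)=aU_{n-1}(a,b)-bU_{n-2}(a,b)$ for $n>1$, and $V_0(a,b)=2$, $V_1(a,b)=a$, $V_n(a,b)=aV_{n-1}(a,b)-bV_{n-2}(a,b)$ for $n>1$. *)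

theory Defs
  imports "Graph_Theory.Graph_Theory"
begin

text \<open>
  Undirected graphs, possibly with loops, are symmetric digraphs (\<^locale>\<open>pseudo_graph\<close>).
  In an independent set, \<open>u = v\<close> is deliberately not excluded: a vertex with a loop is adjacent to
  itself and hence lies in no independent set.
\<close>

definition independent_set :: "('a, 'b) pre_digraph \<Rightarrow> 'a set \<Rightarrow> bool" where
  "independent_set G S \<longleftrightarrow> S \<subseteq> verts G \<and> (\<forall>u\<in>S. \<forall>v\<in>S. \<not> u \<rightarrow>\<^bsub>G\<^esub> v)"

definition num_independent_sets :: "('a, 'b) pre_digraph \<Rightarrow> nat" where
  "num_independent_sets G = card {S. independent_set G S}"

text \<open>
  The vertices of \<open>C(n, a, b)\<close> are pairs \<open>(v, j)\<close> with \<open>v < n\<close> and \<open>j < a\<close>, where \<open>v\<close> represents an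
  element of the integers modulo \<open>n\<close>. The complete graph attached at \<open>v\<close> is \<open>{v} \<times> {..<a}\<close>; its
  vertex \<open>(v, 0)\<close> is the chain vertex and the others are blade vertices. All blade vertices of one
  complete graph play the same role, so up to isomorphism it does not matter which \<open>a - b\<close> of them
  are joined to the preceding chain vertex; we take those with \<open>1 \<le> j \<le> a - b\<close>. The definition is
  meaningful for \<open>n \<ge> 1\<close> and \<open>1 \<le> b \<le> a\<close>: there are only \<open>a - 1\<close> blade vertices to choose from.
  For \<open>n = 1\<close> the cycle is a loop, for \<open>n = 2\<close> it is a single edge.
\<close>

definition cycle_edges :: "nat \<Rightarrow> ((nat \<times> nat) \<times> (nat \<times> nat)) set" where
  "cycle_edges n = {((v, 0), ((v + 1) mod n, 0)) | v. v < n}"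

definition clique_edges :: "nat \<Rightarrow> nat \<Rightarrow> ((nat \<times> nat) \<times> (nat \<times> nat)) set" where
  "clique_edges n a = {((v, i), (v, j)) | v i j. v < n \<and> i < a \<and> j < a \<and> i \<noteq> j}"

definition extra_edges :: "nat \<Rightarrow> nat \<Rightarrow> nat \<Rightarrow> ((nat \<times> nat) \<times> (nat \<times> nat)) set" where
  "extra_edges n a b = {((v, 0), ((v + 1) mod n, j)) | v j. v < n \<and> 1 \<le> j \<and> j \<le> a - b}"

definition chainsaw :: "nat \<Rightarrow> nat \<Rightarrow> nat \<Rightarrow> (nat \<times> nat) pair_pre_digraph" where
  "chainsaw n a b = mk_symmetric (with_proj
     \<lparr> pverts = {..<n} \<times> {..<a},
       parcs = cycle_edges n \<union> clique_edges n a \<union> extra_edges n a b \<rparr>)"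

lemma chainsaw_pseudo_graph:
  assumes "1 \<le> n" "1 \<le> b" "b \<le> a"
  shows "pair_pseudo_graph (chainsaw n a b)"
proof -
  let ?V = "{..<n} \<times> {..<a}"
  let ?E = "cycle_edges n \<union> clique_edges n a \<union> extra_edges n a b"
  have sub: "?E \<subseteq> ?V \<times> ?V"
    using assms by (auto simp: cycle_edges_def clique_edges_def extra_edges_def)
  then have "finite ?E"
    by (rule finite_subset) simp
  with sub interpret pair_fin_digraph "\<lparr> pverts = ?V, parcs = ?E \<rparr>"
    by unfold_locales auto
  interpret S: pair_fin_digraph "chainsaw n a b"
    unfolding chainsaw_def by (rule pair_fin_digraph_mk_symmetric)
  have "sym (\<Union>e\<in>R. {(fst e, snd e), (snd e, fst e)})" for R :: "((nat \<times> nat) \<times> (nat \<times> nat)) set"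
    by (rule symI) blast
  then have "symmetric (with_proj (chainsaw n a b))"
    by (simp only: symmetric_def with_proj_simps chainsaw_def parcs_mk_symmetric)
  then show ?thesis
    by unfold_locales
qed

definition broken_chainsaw ::
    "nat \<Rightarrow> nat \<Rightarrow> nat \<Rightarrow> (nat \<times> nat, (nat \<times> nat) \<times> (nat \<times> nat)) pre_digraph" where
  "broken_chainsaw n a b = pre_digraph.del_vert (with_proj (chainsaw (n + 1) a b)) (0, 0)"

fun lucas_U :: "nat \<Rightarrow> int \<Rightarrow> int \<Rightarrow> int" where
  "lucas_U 0 a b = 0"
| "lucas_U (Suc 0) a b = 1"
| "lucas_U (Suc (Suc n)) a b = a * lucas_U (Suc n) a b - b * lucas_U n a b"

fun lucas_V :: "nat \<Rightarrow> int \<Rightarrow> int \<Rightarrow> int" where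
  "lucas_V 0 a b = 2"
| "lucas_V (Suc 0) a b = a"
| "lucas_V (Suc (Suc n)) a b = a * lucas_V (Suc n) a b - b * lucas_V n a b"

end

theory Submission
  imports Defs
begin

text \<open>
  An independent set meets each of the \<open>n\<close> cliques in at most one vertex, so it is encoded by a list
  of \<open>n\<close> letters in \<open>{0..a}\<close>: the index of the chosen vertex, or \<open>a\<close> if none is chosen. The edges
  between consecutive cliques say exactly that the letter \<open>0\<close> is followed cyclically by one of the
  \<open>b\<close> letters greater than \<open>a - b\<close>. Cutting the cycle at clique \<open>0\<close>, whose letter is \<open>y\<close>, leaves
  words leading to \<open>y\<close>, whose number satisfies the recurrence \<open>N (k + 2) = a * N (k + 1) + b * N k\<close>.
  The broken chainsaw is the case \<open>y \<noteq> 0\<close>, where the successor of \<open>y\<close> is unconstrained; the letter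
  \<open>y = 0\<close> contributes \<open>b * U (n - 1)\<close> more, and \<open>V n = U (n + 1) + b * U (n - 1)\<close> for \<open>U, V\<close> with
  parameters \<open>(a, -b)\<close>.
\<close>

section \<open>Encoding by words\<close>

definition follows :: "nat \<Rightarrow> nat \<Rightarrow> nat \<Rightarrow> nat \<Rightarrow> bool" where
  "follows a b x z \<longleftrightarrow> (x = 0 \<longrightarrow> a - b < z)"

text \<open>The target letter \<open>y\<close> stays outside the counted word, so prepending letters
  leaves it fixed and the count recurses on \<open>k\<close>.\<close>

definition words_to :: "nat \<Rightarrow> nat \<Rightarrow> nat \<Rightarrow> nat \<Rightarrow> nat list set" where
  "words_to a b k y =
     {xs. length xs = k \<and> set xs \<subseteq> {..a} \<and> successively (follows a b) (xs @ [y])}"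

definition cyclic_words :: "nat \<Rightarrow> nat \<Rightarrow> nat \<Rightarrow> nat list set" where
  "cyclic_words a b n =
     {xs. length xs = n \<and> set xs \<subseteq> {..a} \<and> (\<forall>v<n. follows a b (xs ! v) (xs ! ((v + 1) mod n)))}"

text \<open>The bound \<open>j < a\<close> makes the letter \<open>a\<close> contribute no
  vertex.\<close>

definition word_set :: "nat \<Rightarrow> nat list \<Rightarrow> (nat \<times> nat) set" where
  "word_set a xs = {(v, j). v < length xs \<and> j < a \<and> xs ! v = j}"

section \<open>Counting words that lead to a given letter\<close>

lemma finite_words_to [simp]: "finite (words_to a b k y)"
  by (rule finite_subset[OF _ finite_lists_length_eq[of "{..a}" k]]) (auto simp: words_to_def)

lemma card_Cons_image: "card ((\<lambda>(x, xs). x # xs) ` (A \<times> B)) = card A * card B"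
  by (subst card_image) (auto intro!: inj_onI simp: card_cartesian_product)

lemma words_to_0: "words_to a b 0 y = {[]}"
  by (auto simp: words_to_def)

lemma card_words_to_1: "card (words_to a b (Suc 0) y) = a + (if a - b < y then 1 else 0)"
proof -
  have "words_to a b (Suc 0) y = (\<lambda>x. [x]) ` ({1..a} \<union> (if a - b < y then {0} else {}))"
    by (auto simp: words_to_def length_Suc_conv follows_def)
  moreover have "inj_on (\<lambda>x. [x]) X" for X :: "nat set"
    by (auto intro: inj_onI)
  ultimately show ?thesis
    by (simp add: card_image)
qed

text \<open>A letter above \<open>a - b\<close> is nonzero and so constrains nothing after it:
  \<open>b\<close> choices for the head, and any tail in \<open>words_to a b k y\<close>.\<close>

lemma card_words_to_after_0:
  assumes "b \<le> a"
  shows "card {xs \<in> words_to a b (Suc k) y. a - b < hd xs} = b * card (words_to a b k y)"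
proof -
  have "{xs \<in> words_to a b (Suc k) y. a - b < hd xs} =
      (\<lambda>(x, xs). x # xs) ` ({a - b<..a} \<times> words_to a b k y)"
    using assms
    by (auto simp: words_to_def length_Suc_conv follows_def successively_Cons image_iff)
  then show ?thesis
    using assms by (simp add: card_Cons_image)
qed

text \<open>Split by the first letter: each of the \<open>a\<close> nonzero letters may precede any
  word, while \<open>0\<close> needs a next letter above \<open>a - b\<close>.\<close>

lemma card_words_to_Suc_Suc:
  assumes "b \<le> a"
  shows "card (words_to a b (Suc (Suc k)) y)
       = a * card (words_to a b (Suc k) y) + b * card (words_to a b k y)"
proof -
  let ?A = "(\<lambda>(x, xs). x # xs) ` ({1..a} \<times> words_to a b (Suc k) y)"
  let ?B = "(#) 0 ` {xs \<in> words_to a b (Suc k) y. a - b < hd xs}"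
  have "words_to a b (Suc (Suc k)) y = ?A \<union> ?B"
    by (auto simp: words_to_def length_Suc_conv follows_def successively_Cons image_iff)
  moreover have "?A \<inter> ?B = {}"
    by auto
  moreover have "card ?B = b * card (words_to a b k y)"
    using assms by (simp add: card_image card_words_to_after_0)
  moreover have "card ?A = a * card (words_to a b (Suc k) y)"
    by (simp add: card_Cons_image)
  ultimately show ?thesis
    by (simp add: card_Un_disjoint)
qed

text \<open>Only the initial values depend on \<open>y\<close>; for \<open>y = 0\<close> they are
  \<open>1\<close> and \<open>a\<close>, since \<open>0\<close> cannot precede
  \<open>0\<close>.\<close>

lemma card_words_to_0_eq_lucas_U:
  assumes "b \<le> a"
  shows "int (card (words_to a b k 0)) = lucas_U (Suc k) (int a) (- int b)"
proof (induction k rule: induct_nat_012)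
  case (ge2 k)
  then show ?case
    using assms by (simp add: card_words_to_Suc_Suc del: lucas_U.simps(2))
qed (simp_all add: words_to_0 card_words_to_1)

text \<open>The recurrence is linear, so it passes to the sum over \<open>y\<close>. The initial
  values are \<open>a\<close> and \<open>a * a + b\<close>, because \<open>0\<close> may precede
  exactly \<open>b\<close> of the letters \<open>y\<close>.\<close>

lemma sum_card_words_to_eq_lucas_U:
  assumes "b \<le> a"
  shows "(\<Sum>y = 1..a. int (card (words_to a b k y))) = lucas_U (Suc (Suc k)) (int a) (- int b)"
proof (induction k rule: induct_nat_012)
  case 1
  have "{1..a} \<inter> {y. a - b < y} = {a - b<..a}"
    by auto
  then have "(\<Sum>y = 1..a. if a - b < y then 1 else 0 :: int) = int b"
    using assms by (simp add: sum.If_cases)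
  then show ?case
    by (simp add: card_words_to_1 sum.distrib if_distrib[of int] cong: if_cong)
next
  case (ge2 k)
  then show ?case
    using assms
    by (simp add: card_words_to_Suc_Suc sum.distrib flip: sum_distrib_left)
qed (simp_all add: words_to_0)

section \<open>Cyclic words and the second Lucas sequence\<close>

lemma lucas_V_eq_lucas_U:
  "lucas_V (Suc n) a b = lucas_U (Suc (Suc n)) a b - b * lucas_U n a b"
proof (induction n rule: induct_nat_012)
  case (ge2 n)
  have "lucas_V (Suc (Suc (Suc n))) a b = a * lucas_V (Suc (Suc n)) a b - b * lucas_V (Suc n) a b"
    by simp
  then show ?case
    unfolding ge2.IH by (simp add: algebra_simps)
qed (simp_all add: algebra_simps)

text \<open>Repeating the first letter at the end turns the cyclic condition into a linear
  one.\<close>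

lemma Cons_in_cyclic_words_iff:
  "y # xs \<in> cyclic_words a b (Suc k) \<longleftrightarrow>
     length xs = k \<and> y \<le> a \<and> set xs \<subseteq> {..a} \<and> successively (follows a b) (y # xs @ [y])"
proof (cases "length xs = k")
  case True
  \<comment> \<open>At \<open>v = k\<close> the modulus wraps around to the head \<open>y\<close>,
    and position \<open>Suc k\<close> of the extended list is the appended \<open>y\<close>.\<close>
  have "(y # xs) ! v = (y # xs @ [y]) ! v \<and>
      (y # xs) ! ((v + 1) mod Suc k) = (y # xs @ [y]) ! Suc v" if "v < Suc k" for v
    using True that by (cases "v = k") (auto simp: nth_append nth_Cons')
  then have "(\<forall>v<Suc k. follows a b ((y # xs) ! v) ((y # xs) ! ((v + 1) mod Suc k))) \<longleftrightarrow>
      (\<forall>v<Suc k. follows a b ((y # xs @ [y]) ! v) ((y # xs @ [y]) ! Suc v))"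
    by metis
  also have "\<dots> \<longleftrightarrow> successively (follows a b) (y # xs @ [y])"
    by (simp add: successively_conv_nth True)
  finally show ?thesis
    using True by (simp add: cyclic_words_def)
qed (auto simp: cyclic_words_def)

text \<open>A nonzero head imposes nothing on its successor, so only the path from the second letter
  back to the head is constrained.\<close>

lemma cyclic_words_nonzero_eq:
  assumes "b \<le> a"
  shows "{xs \<in> cyclic_words a b (Suc k). 0 < hd xs} =
    (\<lambda>(y, xs). y # xs) ` (SIGMA y:{1..a}. words_to a b k y)"
proof (rule set_eqI)
  fix xs
  show "xs \<in> {xs \<in> cyclic_words a b (Suc k). 0 < hd xs} \<longleftrightarrow>
      xs \<in> (\<lambda>(y, xs). y # xs) ` (SIGMA y:{1..a}. words_to a b k y)"
  proof (cases xs)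
    case Nil
    then show ?thesis
      by (auto simp: cyclic_words_def)
  next
    case (Cons y ys)
    then show ?thesis
      by (auto simp: Cons_in_cyclic_words_iff words_to_def successively_Cons follows_def image_iff)
  qed
qed

lemma card_cyclic_words_nonzero:
  assumes "b \<le> a"
  shows "int (card {xs \<in> cyclic_words a b (Suc k). 0 < hd xs})
       = lucas_U (Suc (Suc k)) (int a) (- int b)"
proof -
  have "inj_on (\<lambda>(y, xs). y # xs) X" for X :: "(nat \<times> nat list) set"
    by (auto intro!: inj_onI)
  then have "int (card {xs \<in> cyclic_words a b (Suc k). 0 < hd xs}) =
      (\<Sum>y = 1..a. int (card (words_to a b k y)))"
    by (simp add: cyclic_words_nonzero_eq card_image card_SigmaI assms)
  then show ?thesis
    by (simp only: sum_card_words_to_eq_lucas_U[OF assms])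
qed

text \<open>For \<open>k > 0\<close>, the letter after the leading \<open>0\<close> has
  \<open>b\<close> choices, none of them restrictive, and the remaining \<open>k - 1\<close> letters
  lead back to \<open>0\<close>.\<close>

lemma card_cyclic_words_zero:
  assumes "b \<le> a"
  shows "int (card {xs \<in> cyclic_words a b (Suc k). hd xs = 0})
       = int b * lucas_U k (int a) (- int b)"
proof -
  have eq: "{xs \<in> cyclic_words a b (Suc k). hd xs = 0} =
      (#) 0 ` {xs \<in> words_to a b k 0. xs \<noteq> [] \<and> a - b < hd xs}"
  proof (rule set_eqI)
    fix xs
    show "xs \<in> {xs \<in> cyclic_words a b (Suc k). hd xs = 0} \<longleftrightarrow>
        xs \<in> (#) 0 ` {xs \<in> words_to a b k 0. xs \<noteq> [] \<and> a - b < hd xs}"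
    proof (cases xs)
      case Nil
      then show ?thesis
        by (auto simp: cyclic_words_def)
    next
      case (Cons y ys)
      then show ?thesis
        by (cases ys)
          (auto simp: Cons_in_cyclic_words_iff words_to_def successively_Cons follows_def)
    qed
  qed
  show ?thesis
  proof (cases k)
    case 0
    \<comment> \<open>The word \<open>[0]\<close> would need \<open>0\<close> to follow itself,
      which is the loop of the one-vertex cycle; this agrees with
      \<open>lucas_U 0 a b = 0\<close>.\<close>
    have "{xs \<in> cyclic_words a b (Suc k). hd xs = 0} = {}"
      unfolding eq by (auto simp: 0 words_to_0)
    then show ?thesis
      using 0 by (simp only:) simp
  next
    case (Suc m)
    have "{xs \<in> cyclic_words a b (Suc k). hd xs = 0} =
        (#) 0 ` {xs \<in> words_to a b (Suc m) 0. a - b < hd xs}"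
      unfolding eq by (auto simp: Suc words_to_def)
    then have "card {xs \<in> cyclic_words a b (Suc k). hd xs = 0} = b * card (words_to a b m 0)"
      using assms by (simp add: card_image card_words_to_after_0)
    then show ?thesis
      using assms by (simp add: Suc card_words_to_0_eq_lucas_U)
  qed
qed

lemma card_cyclic_words:
  assumes "b \<le> a"
  shows "int (card (cyclic_words a b (Suc k))) = lucas_V (Suc k) (int a) (- int b)"
proof -
  have "finite (cyclic_words a b (Suc k))"
    by (rule finite_subset[OF _ finite_lists_length_eq[of "{..a}" "Suc k"]])
      (auto simp: cyclic_words_def)
  moreover have "cyclic_words a b (Suc k) =
      {xs \<in> cyclic_words a b (Suc k). 0 < hd xs} \<union> {xs \<in> cyclic_words a b (Suc k). hd xs = 0}"
    by auto
  ultimately have "card (cyclic_words a b (Suc k)) =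
      card {xs \<in> cyclic_words a b (Suc k). 0 < hd xs} +
      card {xs \<in> cyclic_words a b (Suc k). hd xs = 0}"
    by (subst card_Un_disjoint[symmetric]) auto
  then show ?thesis
    using assms
    by (simp add: card_cyclic_words_nonzero card_cyclic_words_zero lucas_V_eq_lucas_U
        del: lucas_U.simps lucas_V.simps)
qed

section \<open>Independent sets of the chainsaw as cyclic words\<close>

lemma dominates_chainsaw_iff:
  "u \<rightarrow>\<^bsub>with_proj (chainsaw n a b)\<^esub> v \<longleftrightarrow>
     (u, v) \<in> cycle_edges n \<union> clique_edges n a \<union> extra_edges n a b \<or>
     (v, u) \<in> cycle_edges n \<union> clique_edges n a \<union> extra_edges n a b"
proof -
  have "(u, v) \<in> (\<Union>e\<in>E. {(fst e, snd e), (snd e, fst e)}) \<longleftrightarrow> (u, v) \<in> E \<or> (v, u) \<in> E"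
    for E :: "((nat \<times> nat) \<times> (nat \<times> nat)) set"
    by (auto intro: rev_bexI)
  then show ?thesis
    by (auto simp: chainsaw_def parcs_mk_symmetric)
qed

lemma independent_set_chainsaw_iff:
  "independent_set (with_proj (chainsaw n a b)) S \<longleftrightarrow>
     S \<subseteq> {..<n} \<times> {..<a} \<and>
     (\<forall>v i j. (v, i) \<in> S \<longrightarrow> (v, j) \<in> S \<longrightarrow> i = j) \<and>
     (\<forall>v j. (v, 0) \<in> S \<longrightarrow> ((v + 1) mod n, j) \<in> S \<longrightarrow> a - b < j)"
proof (cases "S \<subseteq> {..<n} \<times> {..<a}")
  case True
  \<comment> \<open>The cycle edge is the missing case \<open>j = 0\<close> of the extra
    edges.\<close>
  have joint: "cycle_edges n \<union> extra_edges n a b =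
      {((v, 0), ((v + 1) mod n, j)) | v j. v < n \<and> j \<le> a - b}"
    by (auto simp: cycle_edges_def extra_edges_def Suc_le_eq)
  have "pverts (chainsaw n a b) = {..<n} \<times> {..<a}"
    by (simp add: chainsaw_def)
  \<comment> \<open>Independence is symmetric in the two endpoints, so the reversed arcs add no
    condition.\<close>
  then have "independent_set (with_proj (chainsaw n a b)) S \<longleftrightarrow>
      (\<forall>u v. (u, v) \<in> clique_edges n a \<longrightarrow> u \<in> S \<longrightarrow> v \<notin> S) \<and>
      (\<forall>u v. (u, v) \<in> cycle_edges n \<union> extra_edges n a b \<longrightarrow> u \<in> S \<longrightarrow> v \<notin> S)"
    unfolding independent_set_def dominates_chainsaw_iff
    by (simp only: with_proj_simps True simp_thms) blast
  also have "(\<forall>u v. (u, v) \<in> clique_edges n a \<longrightarrow> u \<in> S \<longrightarrow> v \<notin> S) \<longleftrightarrow>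
      (\<forall>v i j. (v, i) \<in> S \<longrightarrow> (v, j) \<in> S \<longrightarrow> i = j)"
  proof -
    have "((v, i), (w, j)) \<in> clique_edges n a \<longleftrightarrow> v = w \<and> v < n \<and> i < a \<and> j < a \<and> i \<noteq> j" for v w i j
      by (auto simp: clique_edges_def)
    moreover have "v < n \<and> i < a" if "(v, i) \<in> S" for v i
      using True that by auto
    ultimately show ?thesis
      by (metis prod.exhaust)
  qed
  also have "(\<forall>u v. (u, v) \<in> cycle_edges n \<union> extra_edges n a b \<longrightarrow> u \<in> S \<longrightarrow> v \<notin> S) \<longleftrightarrow>
      (\<forall>v j. (v, 0) \<in> S \<longrightarrow> ((v + 1) mod n, j) \<in> S \<longrightarrow> a - b < j)"
  proof -
    have "((v, i), u) \<in> cycle_edges n \<union> extra_edges n a b \<longleftrightarrow>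
        v < n \<and> i = 0 \<and> (\<exists>j\<le>a - b. u = ((v + 1) mod n, j))" for v i u
      by (auto simp: joint)
    moreover have "v < n" if "(v, i) \<in> S" for v i
      using True that by auto
    ultimately show ?thesis
      by (metis not_le prod.exhaust)
  qed
  finally show ?thesis
    using True by simp
qed (simp add: independent_set_def chainsaw_def)

lemma independent_set_word_set_iff:
  assumes "1 \<le> n" "1 \<le> b" "b \<le> a" "length xs = n" "set xs \<subseteq> {..a}"
  shows "independent_set (with_proj (chainsaw n a b)) (word_set a xs) \<longleftrightarrow> xs \<in> cyclic_words a b n"
proof -
  have lt: "(v + 1) mod n < n" for v
    using assms by simp
  then have le: "xs ! ((v + 1) mod n) \<le> a" for v
    using assms by (metis atMost_iff nth_mem subsetD)
  have "independent_set (with_proj (chainsaw n a b)) (word_set a xs) \<longleftrightarrow>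
      (\<forall>v<n. xs ! v = 0 \<longrightarrow> xs ! ((v + 1) mod n) < a \<longrightarrow> a - b < xs ! ((v + 1) mod n))"
    using assms lt by (auto simp: independent_set_chainsaw_iff word_set_def)
  also have "\<dots> \<longleftrightarrow> (\<forall>v<n. follows a b (xs ! v) (xs ! ((v + 1) mod n)))"
  proof -
    \<comment> \<open>The letter \<open>a\<close> (no vertex chosen) may always follow
      \<open>0\<close>, because \<open>1 \<le> b\<close> gives \<open>a - b < a\<close>.\<close>
    have "(z < a \<longrightarrow> a - b < z) \<longleftrightarrow> a - b < z" if "z \<le> a" for z
      using that assms by linarith
    then show ?thesis
      using le unfolding follows_def by blast
  qed
  also have "\<dots> \<longleftrightarrow> xs \<in> cyclic_words a b n"
    using assms by (simp add: cyclic_words_def)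
  finally show ?thesis .
qed

lemma inj_on_word_set: "inj_on (word_set a) {xs. length xs = n \<and> set xs \<subseteq> {..a}}"
proof (rule inj_onI, clarify)
  fix xs ys
  assume le: "set xs \<subseteq> {..a}" "set ys \<subseteq> {..a}" and len: "length ys = length xs"
    and eq: "word_set a xs = word_set a ys"
  show "xs = ys"
  proof (rule nth_equalityI)
    fix v
    assume v: "v < length xs"
    \<comment> \<open>Varying \<open>j\<close> recovers every letter below \<open>a\<close>; the
      letter \<open>a\<close> is recognised by the absence of a vertex.\<close>
    have "xs ! v < a \<and> xs ! v = j \<longleftrightarrow> ys ! v < a \<and> ys ! v = j" for j
      using arg_cong[OF eq, of "\<lambda>S. (v, j) \<in> S"] v len by (auto simp: word_set_def)
    moreover have "xs ! v \<le> a" "ys ! v \<le> a"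
      using le v len by (metis atMost_iff nth_mem subsetD)+
    ultimately show "xs ! v = ys ! v"
      by (metis le_neq_implies_less)
  qed (simp add: len)
qed

lemma independent_set_eq_word_set:
  assumes "independent_set (with_proj (chainsaw n a b)) S"
  obtains xs where "length xs = n" "set xs \<subseteq> {..a}" "S = word_set a xs"
proof -
  have sub: "S \<subseteq> {..<n} \<times> {..<a}"
    and uniq: "\<And>v i j. (v, i) \<in> S \<Longrightarrow> (v, j) \<in> S \<Longrightarrow> i = j"
    using assms unfolding independent_set_chainsaw_iff by blast+
  \<comment> \<open>Uniqueness within a clique makes \<open>THE\<close> well defined; the default
    \<open>a\<close> records an unmet clique.\<close>
  define f where "f v = (if \<exists>j. (v, j) \<in> S then THE j. (v, j) \<in> S else a)" for v
  have f_eq: "f v = j" if "(v, j) \<in> S" for v j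
    using that uniq by (auto simp: f_def)
  have f_cases: "(v, f v) \<in> S \<or> f v = a" for v
    using f_eq by (metis f_def)
  show ?thesis
  proof
    show "set (map f [0..<n]) \<subseteq> {..a}"
      using f_cases sub by (fastforce simp: less_imp_le)
    show "S = word_set a (map f [0..<n])"
      using f_cases f_eq sub by (fastforce simp: word_set_def)
  qed simp
qed

lemma bij_betw_word_set:
  assumes "1 \<le> n" "1 \<le> b" "b \<le> a"
  shows "bij_betw (word_set a) (cyclic_words a b n)
           {S. independent_set (with_proj (chainsaw n a b)) S}"
proof (rule bij_betw_imageI)
  show "inj_on (word_set a) (cyclic_words a b n)"
    by (rule inj_on_subset[OF inj_on_word_set[of a n]]) (auto simp: cyclic_words_def)
  show "word_set a ` cyclic_words a b n = {S. independent_set (with_proj (chainsaw n a b)) S}"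
  proof (intro equalityI subsetI)
    fix S
    assume "S \<in> word_set a ` cyclic_words a b n"
    then show "S \<in> {S. independent_set (with_proj (chainsaw n a b)) S}"
      using independent_set_word_set_iff[OF assms] by (auto simp: cyclic_words_def)
  next
    fix S
    assume "S \<in> {S. independent_set (with_proj (chainsaw n a b)) S}"
    then show "S \<in> word_set a ` cyclic_words a b n"
      using independent_set_word_set_iff[OF assms] independent_set_eq_word_set
      by (metis imageI mem_Collect_eq)
  qed
qed

section \<open>Removing a chain vertex, and the two counts\<close>

lemma independent_set_del_vert_iff:
  "independent_set (pre_digraph.del_vert G u) S \<longleftrightarrow> independent_set G S \<and> u \<notin> S"
  unfolding independent_set_def
  by (fastforce simp: pre_digraph.del_vert_def arcs_ends_def arc_to_ends_def)

theorem theorem1p2: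
  fixes n a b :: nat
  assumes "1 \<le> n" and "1 \<le> b" and "b \<le> a"
  shows "int (num_independent_sets (broken_chainsaw n a b)) = lucas_U (n + 2) (int a) (- int b)
       \<and> int (num_independent_sets (with_proj (chainsaw n a b))) = lucas_V n (int a) (- int b)"
proof
  have bij: "bij_betw (word_set a) (cyclic_words a b (Suc n))
      {S. independent_set (with_proj (chainsaw (Suc n) a b)) S}"
    using assms by (intro bij_betw_word_set) auto
  \<comment> \<open>The removed vertex belongs to clique \<open>0\<close>, whose letter is the head;
    \<open>0 < a\<close> ensures that the letter \<open>0\<close> stands for a vertex.\<close>
  have mem: "(0, 0) \<in> word_set a xs \<longleftrightarrow> hd xs = 0" if "xs \<in> cyclic_words a b (Suc n)" for xs
    using that assms by (cases xs) (auto simp: word_set_def cyclic_words_def)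
  have "{S. independent_set (broken_chainsaw n a b) S} =
      {S \<in> word_set a ` cyclic_words a b (Suc n). (0, 0) \<notin> S}"
    using bij by (auto simp: broken_chainsaw_def independent_set_del_vert_iff bij_betw_def)
  also have "\<dots> = word_set a ` {xs \<in> cyclic_words a b (Suc n). 0 < hd xs}"
    using mem by auto
  finally have "num_independent_sets (broken_chainsaw n a b) =
      card {xs \<in> cyclic_words a b (Suc n). 0 < hd xs}"
    using bij
    by (auto simp: num_independent_sets_def bij_betw_def intro!: card_image intro: inj_on_subset)
  then show "int (num_independent_sets (broken_chainsaw n a b)) = lucas_U (n + 2) (int a) (- int b)"
    using card_cyclic_words_nonzero[OF assms(3), of n] by (simp del: lucas_U.simps)
next
  obtain k where "n = Suc k"
    using assms by (cases n) auto
  then show "int (num_independent_sets (with_proj (chainsaw n a b))) = lucas_V n (int a) (- int b)"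
    using card_cyclic_words[OF assms(3), of k] bij_betw_same_card[OF bij_betw_word_set[OF assms]]
    by (simp add: num_independent_sets_def del: lucas_V.simps)
qed

end
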